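(* The Euler–Mascheroni constant $\gamma$ satisfies $$\gamma=\lim_{m\to\infty}\sum_{k=1}^{m}\binom{m}{k}\frac{(-1)^{k}}{k}\ln(k!).$$
   Context: The Euler–Mascheroni constant is $\gamma=\lim_{m\to\infty}\left(1+\frac12+\frac13+\dots+\frac1m-\ln m\right)$. Here $m$ ranges over the positive integers, $\binom{m}{k}$ denotes the binomial coefficient, and $\ln$ is the natural logarithm. *)

theory Defs
  imports "HOL-Analysis.Analysis"
begin

end

theory Submission
  imports Defs
begin

text \<open>
  Write \<open>S m\<close> for the sum in the theorem. Euler's product gives
  \<open>ln (k!) = (\<Sum>j\<ge>1. k * ln (1 + 1/j) - ln (1 + k/j))\<close>. Summing over \<open>k\<close> inside this series, with
  the alternating binomial weights, yields
  \<open>S m = (\<Sum>j\<ge>1. A m (1/j) - ln (1 + 1/j))\<close>, where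
  \<open>A m t = - (\<Sum>k=1..m. (m choose k) * (-1)\<^sup>k / k * ln (1 + k * t))\<close>.
  Since \<open>\<gamma> = (\<Sum>j\<ge>1. 1/j - ln (1 + 1/j))\<close>, this becomes
  \<open>\<gamma> - S m = (\<Sum>j\<ge>1. 1/j - A m (1/j))\<close> (lemma \<open>euler_mascheroni_minus_sum\<close>), and it remains to
  see that \<open>A m t\<close> is close to \<open>t\<close>.

  The derivative of \<open>t - A m t\<close> is \<open>\<Sum>k\<le>m. (m choose k) * (-1)\<^sup>k / (1 + k * t)\<close>, and by partial
  fractions (lemma \<open>alternating_binomial_reciprocal_sum\<close>) this equals the product
  \<open>\<Prod>k=1..m. k * t / (1 + k * t)\<close>, which for \<open>m \<ge> 1\<close> and
  \<open>t > 0\<close> lies between \<open>0\<close> and \<open>t / harm m\<close>. Hence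
  \<open>0 \<le> t - A m t \<le> t\<^sup>2 / harm m\<close> (lemma \<open>binomial_log_sum_bounds\<close>), so that
  \<open>0 \<le> \<gamma> - S m \<le> (\<Sum>j\<ge>1. 1/j\<^sup>2) / harm m\<close>, which tends to \<open>0\<close> because the harmonic series
  diverges.
\<close>

text \<open>
  This is \<open>- A m t\<close> in the notation above: keeping the sign of the coefficients of the theorem
  makes \<open>binomial_log_sum m t + t\<close> the nonnegative error term.
\<close>
definition binomial_log_sum :: "nat \<Rightarrow> real \<Rightarrow> real" where
  "binomial_log_sum m t = (\<Sum>k=1..m. real (m choose k) * ((-1) ^ k / real k) * ln (1 + real k * t))"

lemma ln_one_plus_divide:
  fixes x y :: real
  assumes "y > 0" "x \<ge> 0"
  shows "ln (1 + x / y) = ln (y + x) - ln y"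
proof -
  have "1 + x / y = (y + x) / y"
    using assms by (simp add: field_simps)
  thus ?thesis
    using assms by (simp add: ln_divide_pos)
qed

text \<open>
  The logarithm of Euler's product
  \<open>k! = (\<Prod>j\<ge>1. (1 + 1/j)\<^sup>k / (1 + k/j))\<close>, with \<open>j = n + 1\<close>. Raising \<open>k\<close> by one
  changes the series by a telescoping one with sum \<open>ln (k + 1)\<close>.
\<close>
lemma sums_ln_fact:
  "(\<lambda>n. real k * ln (1 + 1 / real (Suc n)) - ln (1 + real k * (1 / real (Suc n)))) sums ln (fact k)"
proof (induction k)
  case 0
  then show ?case by simp
next
  case (Suc k)
  define g where "g n = ln (real (Suc n)) - ln (real (Suc n) + real k)" for n
  have "g \<longlonglongrightarrow> 0"
    unfolding g_def by real_asymp
  from telescope_sums[OF this]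
  have "(\<lambda>n. g (Suc n) - g n) sums ln (real (Suc k))"
    by (simp add: g_def add.commute)
  from sums_add[OF Suc this]
  have *: "(\<lambda>n. real k * ln (1 + 1 / real (Suc n)) - ln (1 + real k * (1 / real (Suc n)))
             + (g (Suc n) - g n)) sums (ln (fact k) + ln (real (Suc k)))" .
  have eq: "real k * ln (1 + 1 / real (Suc n)) - ln (1 + real k * (1 / real (Suc n)))
             + (g (Suc n) - g n)
           = real (Suc k) * ln (1 + 1 / real (Suc n)) - ln (1 + real (Suc k) * (1 / real (Suc n)))"
    for n
    using ln_one_plus_divide[of "real (Suc n)" 1] ln_one_plus_divide[of "real (Suc n)" "real k"]
      ln_one_plus_divide[of "real (Suc n)" "real (Suc k)"]
    by (simp add: g_def algebra_simps)
  have "ln (fact k) + ln (real (Suc k)) = ln (fact (Suc k) :: real)"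
    by (simp add: ln_mult del: of_nat_Suc)
  with * show ?case
    unfolding eq by simp
qed

text \<open>
  For \<open>t > 0\<close> this is the partial fraction decomposition of the right-hand side. The left-hand
  side is, up to sign, the \<open>m\<close>-th finite difference of \<open>1 / c\<close> with step \<open>t\<close>, so its value for \<open>m + 1\<close> is its value for \<open>m\<close> at
  \<open>c\<close> minus that at \<open>c + t\<close>; hence \<open>c\<close> must be arbitrary in the induction.
\<close>
lemma alternating_binomial_reciprocal_sum:
  fixes c t :: real
  assumes "c > 0" "t \<ge> 0"
  shows "(\<Sum>k\<le>m. real (m choose k) * (-1) ^ k / (c + real k * t))
           = fact m * t ^ m / (\<Prod>k\<le>m. c + real k * t)"
  using assms
proof (induction m arbitrary: c)
  case 0
  then show ?case by simp
next
  case (Suc m)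
  let ?F = "\<lambda>m c. \<Sum>k\<le>m. real (m choose k) * (-1) ^ k / (c + real k * t)"
  define P where "P = (\<Prod>k\<le>m. c + t + real k * t)"
  have pos: "c + real k * t > 0" for k
    using Suc.prems by (simp add: add_pos_nonneg)
  have P0: "P > 0"
    unfolding P_def using Suc.prems by (intro prod_pos) (auto intro: add_pos_nonneg)
  have split: "(\<Prod>k\<le>Suc m. c + real k * t) = c * P"
    by (subst prod.atMost_Suc_shift) (simp add: P_def algebra_simps)
  have Q: "(\<Prod>k\<le>m. c + real k * t) = c * P / (c + real (Suc m) * t)"
    using split pos[of "Suc m"] by (simp add: field_simps)
  have "?F (Suc m) c = 1 / c + (\<Sum>k\<le>m. real (Suc m choose Suc k) * (-1) ^ Suc k / (c + real (Suc k) * t))"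
    by (subst sum.atMost_Suc_shift) simp
  also have "(\<Sum>k\<le>m. real (Suc m choose Suc k) * (-1) ^ Suc k / (c + real (Suc k) * t))
      = (\<Sum>k\<le>m. real (m choose Suc k) * (-1) ^ Suc k / (c + real (Suc k) * t)
             - real (m choose k) * (-1) ^ k / (c + t + real k * t))"
  proof (intro sum.cong refl)
    fix k
    have "c + t + real k * t = c + real (Suc k) * t"
      by (simp add: algebra_simps)
    thus "real (Suc m choose Suc k) * (-1) ^ Suc k / (c + real (Suc k) * t)
        = real (m choose Suc k) * (-1) ^ Suc k / (c + real (Suc k) * t)
             - real (m choose k) * (-1) ^ k / (c + t + real k * t)"
      by (simp only: diff_divide_distrib[symmetric]) (simp add: algebra_simps)
  qed
  also have "1 / c + \<dots>
      = (1 / c + (\<Sum>k\<le>m. real (m choose Suc k) * (-1) ^ Suc k / (c + real (Suc k) * t))) - ?F m (c + t)"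
    by (simp add: sum_subtractf)
  also have "1 / c + (\<Sum>k\<le>m. real (m choose Suc k) * (-1) ^ Suc k / (c + real (Suc k) * t))
      = (\<Sum>k\<le>Suc m. real (m choose k) * (-1) ^ k / (c + real k * t))"
    by (subst sum.atMost_Suc_shift) simp
  also have "\<dots> = ?F m c"
    by simp
  also have "?F m c - ?F m (c + t) = fact m * t ^ m / (c * P / (c + real (Suc m) * t)) - fact m * t ^ m / P"
    using Suc.IH[of c] Suc.IH[of "c + t"] Suc.prems by (simp only: Q P_def)
  also have "\<dots> = fact m * t ^ m * (real (Suc m) * t) / (c * P)"
    using P0 Suc.prems(1) by (simp add: field_simps)
  also have "\<dots> = fact (Suc m) * t ^ Suc m / (c * P)"
    by (simp add: mult_ac)
  finally show ?case
    unfolding split .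
qed

text \<open>
  Expanding the reciprocal \<open>\<Prod>k=1..m. 1 + 1 / (k * t)\<close> and keeping only the terms of degree at
  most one in \<open>1 / t\<close> bounds it below by \<open>1 + harm m / t\<close>.
\<close>
lemma prod_mult_harm_le:
  assumes "t > 0"
  shows "(\<Prod>k=1..m. real k * t / (1 + real k * t)) * harm m \<le> t"
proof -
  have "1 + harm m / t \<le> (\<Prod>k=1..m. (1 + real k * t) / (real k * t))"
  proof (induction m)
    case (Suc m)
    have "1 + harm (Suc m) / t \<le> (1 + harm m / t) * (1 + 1 / (real (Suc m) * t))"
    proof -
      define u where "u = 1 / (real (Suc m) * t)"
      have u: "u \<ge> 0"
        using assms by (simp add: u_def)
      have "harm (Suc m) / t = harm m / t + u"
        using assms by (simp add: harm_Suc u_def field_simps del: of_nat_Suc)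
      moreover have "harm m / t * u \<ge> 0"
        using assms u harm_nonneg[of m, where 'a=real] by simp
      ultimately show ?thesis
        unfolding u_def[symmetric] ring_distribs by linarith
    qed
    also have "\<dots> \<le> (\<Prod>k=1..m. (1 + real k * t) / (real k * t)) * (1 + 1 / (real (Suc m) * t))"
      using Suc assms by (intro mult_right_mono) auto
    also have "1 + 1 / (real (Suc m) * t) = (1 + real (Suc m) * t) / (real (Suc m) * t)"
      using assms by (simp add: add_divide_distrib del: of_nat_Suc)
    finally show ?case by simp
  qed (simp add: harm_def)
  moreover have "(\<Prod>k=1..m. real k * t / (1 + real k * t))
      = 1 / (\<Prod>k=1..m. (1 + real k * t) / (real k * t))"
    by (simp add: prod_dividef)
  moreover have "1 + harm m / t > 0"
    using assms harm_nonneg[of m, where 'a=real] by (simp add: add_pos_nonneg)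
  ultimately have "(\<Prod>k=1..m. real k * t / (1 + real k * t)) \<le> 1 / (1 + harm m / t)"
    by (simp add: frac_le)
  hence "(\<Prod>k=1..m. real k * t / (1 + real k * t)) * harm m \<le> 1 / (1 + harm m / t) * harm m"
    by (rule mult_right_mono) (rule harm_nonneg)
  also have "\<dots> \<le> t"
    using assms harm_nonneg[of m, where 'a=real] by (simp add: field_simps add_pos_nonneg)
  finally show ?thesis .
qed

text \<open>
  Differentiation cancels the \<open>1/k\<close> in the coefficients, and the added \<open>s\<close> supplies the missing
  term \<open>k = 0\<close> of the partial fraction decomposition with \<open>c = 1\<close>.
\<close>
lemma has_real_derivative_binomial_log_sum:
  assumes "t \<ge> 0"
  shows "((\<lambda>s. binomial_log_sum m s + s) has_real_derivative
           (\<Prod>k=1..m. real k * t / (1 + real k * t))) (at t)"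
proof -
  have pos: "1 + real k * t > 0" for k
    using assms by (simp add: add_pos_nonneg)
  have "((\<lambda>s. binomial_log_sum m s + s) has_real_derivative
      (\<Sum>k=1..m. real (m choose k) * ((-1) ^ k / real k) * (real k / (1 + real k * t))) + 1) (at t)"
    unfolding binomial_log_sum_def
    using pos by (auto intro!: derivative_eq_intros sum.cong)
  also have "(\<Sum>k=1..m. real (m choose k) * ((-1) ^ k / real k) * (real k / (1 + real k * t))) + 1
      = (\<Sum>k\<le>m. real (m choose k) * (-1) ^ k / (1 + real k * t))"
    by (simp add: atMost_atLeast0 sum.atLeast_Suc_atMost)
  also have "\<dots> = fact m * t ^ m / (\<Prod>k\<le>m. 1 + real k * t)"
    using alternating_binomial_reciprocal_sum[of 1 t m] assms by simp
  also have "(\<Prod>k\<le>m. 1 + real k * t) = (\<Prod>k=1..m. 1 + real k * t)"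
    by (simp add: atMost_atLeast0 prod.atLeast_Suc_atMost)
  also have "fact m * t ^ m / (\<Prod>k=1..m. 1 + real k * t) = (\<Prod>k=1..m. real k * t / (1 + real k * t))"
    by (simp add: prod_dividef prod.distrib fact_prod)
  finally show ?thesis .
qed

text \<open>
  The function \<open>\<lambda>s. binomial_log_sum m s + s\<close> vanishes at \<open>0\<close>, so by the mean value theorem it
  inherits a bound at \<open>t\<close> from its derivative on \<open>(0, t)\<close>. The factor \<open>t\<^sup>2\<close> makes the bound
  summable over \<open>t = 1/j\<close>, and the factor \<open>harm m\<close> makes it uniformly small as \<open>m\<close> grows.
\<close>
lemma binomial_log_sum_bounds:
  assumes "t > 0"
  shows "binomial_log_sum m t + t \<ge> 0"
    and "(binomial_log_sum m t + t) * harm m \<le> t\<^sup>2"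
proof -
  define B where "B s = (\<Prod>k=1..m. real k * s / (1 + real k * s))" for s
  have "\<exists>z. 0 < z \<and> z < t \<and> (binomial_log_sum m t + t) - (binomial_log_sum m 0 + 0) = (t - 0) * B z"
    unfolding B_def using assms by (intro MVT2 has_real_derivative_binomial_log_sum) auto
  then obtain z where z: "0 < z" "z < t" and eq: "binomial_log_sum m t + t = t * B z"
    by (auto simp: binomial_log_sum_def)
  have "B z \<ge> 0"
    using z unfolding B_def by (intro prod_nonneg) auto
  with eq assms show "binomial_log_sum m t + t \<ge> 0" by simp
  have "B z * harm m \<le> z"
    unfolding B_def by (rule prod_mult_harm_le) (fact z)
  with z have "t * (B z * harm m) \<le> t * t"
    using assms by (intro mult_left_mono) auto
  with eq show "(binomial_log_sum m t + t) * harm m \<le> t\<^sup>2"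
    by (simp add: power2_eq_square mult.assoc)
qed

lemma alternating_binomial_sum_from_1:
  assumes "m \<ge> 1"
  shows "(\<Sum>k=1..m. real (m choose k) * (-1) ^ k) = -1"
proof -
  have "(\<Sum>k\<le>m. (-1) ^ k * real (m choose k)) = 0"
    using choose_alternating_sum[of m, where 'a=real] assms by simp
  thus ?thesis
    by (simp add: atMost_atLeast0 sum.atLeast_Suc_atMost mult.commute)
qed

text \<open>
  Inserting Euler's product for each \<open>k!\<close> and summing over \<open>k\<close> first turns the \<open>j\<close>-th terms
  \<open>k * ln (1 + 1/j)\<close> into a single \<open>- ln (1 + 1/j)\<close>. The series
  \<open>\<gamma> = (\<Sum>j\<ge>1. 1/j - ln (1 + 1/j))\<close> contains the same logarithm, so it cancels in the
  difference.
\<close>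
lemma euler_mascheroni_minus_sum:
  assumes "m \<ge> 1"
  shows "(\<lambda>n. binomial_log_sum m (1 / real (Suc n)) + 1 / real (Suc n)) sums
           (euler_mascheroni - (\<Sum>k=1..m. real (m choose k) * ((-1) ^ k / real k) * ln (fact k)))"
proof -
  let ?c = "\<lambda>k. real (m choose k) * ((-1) ^ k / real k)"
  have "(\<lambda>n. \<Sum>k=1..m. ?c k * (real k * ln (1 + 1 / real (Suc n)) - ln (1 + real k * (1 / real (Suc n)))))
          sums (\<Sum>k=1..m. ?c k * ln (fact k))"
    by (intro sums_sum sums_mult sums_ln_fact)
  also have "(\<lambda>n. \<Sum>k=1..m. ?c k * (real k * ln (1 + 1 / real (Suc n)) - ln (1 + real k * (1 / real (Suc n)))))
      = (\<lambda>n. - ln (1 + 1 / real (Suc n)) - binomial_log_sum m (1 / real (Suc n)))"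
  proof
    fix n
    define L where "L = ln (1 + 1 / real (Suc n))"
    have "(\<Sum>k=1..m. ?c k * (real k * L - ln (1 + real k * (1 / real (Suc n)))))
        = (\<Sum>k=1..m. real (m choose k) * (-1) ^ k * L) - binomial_log_sum m (1 / real (Suc n))"
      unfolding binomial_log_sum_def sum_subtractf[symmetric]
      by (intro sum.cong) (auto simp: algebra_simps)
    also have "(\<Sum>k=1..m. real (m choose k) * (-1) ^ k * L) = - L"
      using alternating_binomial_sum_from_1[OF assms] by (simp add: sum_distrib_right[symmetric])
    finally show "(\<Sum>k=1..m. ?c k * (real k * ln (1 + 1 / real (Suc n)) - ln (1 + real k * (1 / real (Suc n)))))
      = - ln (1 + 1 / real (Suc n)) - binomial_log_sum m (1 / real (Suc n))"
      unfolding L_def .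
  qed
  finally have "(\<lambda>n. - ln (1 + 1 / real (Suc n)) - binomial_log_sum m (1 / real (Suc n))) sums
      (\<Sum>k=1..m. ?c k * ln (fact k))" .
  from sums_diff[OF euler_mascheroni_sum_real this]
  have diff: "(\<lambda>n. 1 / real (n + 1) + ln (real (n + 1)) - ln (real (n + 2))
        - (- ln (1 + 1 / real (Suc n)) - binomial_log_sum m (1 / real (Suc n)))) sums
      (euler_mascheroni - (\<Sum>k=1..m. ?c k * ln (fact k)))"
    by (simp add: inverse_eq_divide)
  have eq: "1 / real (n + 1) + ln (real (n + 1)) - ln (real (n + 2))
        - (- ln (1 + 1 / real (Suc n)) - binomial_log_sum m (1 / real (Suc n)))
      = binomial_log_sum m (1 / real (Suc n)) + 1 / real (Suc n)" for n
    using ln_one_plus_divide[of "real (Suc n)" 1] by (simp add: add_ac)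
  show ?thesis
    using diff unfolding eq .
qed

theorem theorem4:
  shows "(\<lambda>m::nat. \<Sum>k=1..m. real (m choose k) * ((-1) ^ k / real k) * ln (fact k :: real))
           \<longlonglongrightarrow> (euler_mascheroni :: real)"
proof -
  define S where "S m = (\<Sum>k=1..m. real (m choose k) * ((-1) ^ k / real k) * ln (fact k :: real))" for m
  define C where "C = (\<Sum>n. (1 / real (Suc n))\<^sup>2)"
  have C: "(\<lambda>n. (1 / real (Suc n))\<^sup>2) sums C"
  proof -
    have "summable (\<lambda>n. inverse (real (Suc n) ^ 2))"
      using inverse_power_summable[of 2, where 'a=real] by (subst summable_Suc_iff) auto
    thus ?thesis
      unfolding C_def by (intro summable_sums) (simp add: power_divide inverse_eq_divide del: of_nat_Suc)
  qed
  have bounds: "0 \<le> euler_mascheroni - S m" "euler_mascheroni - S m \<le> C / harm m" if "m \<ge> 1" for m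
  proof -
    note sums = euler_mascheroni_minus_sum[OF that, folded S_def]
    show "0 \<le> euler_mascheroni - S m"
      by (rule sums_le[OF _ sums_zero sums]) (intro binomial_log_sum_bounds, simp)
    have harm: "harm m > (0::real)" using that by (intro harm_pos) auto
    have "(euler_mascheroni - S m) * harm m \<le> C"
      by (rule sums_le[OF _ sums_mult2[OF sums] C]) (intro binomial_log_sum_bounds, simp)
    thus "euler_mascheroni - S m \<le> C / harm m"
      using harm by (simp add: pos_le_divide_eq)
  qed
  have lower: "\<forall>\<^sub>F m in sequentially. 0 \<le> euler_mascheroni - S m"
    using eventually_ge_at_top[of "1::nat"] by eventually_elim (rule bounds)
  have upper: "\<forall>\<^sub>F m in sequentially. euler_mascheroni - S m \<le> C / harm m"
    using eventually_ge_at_top[of "1::nat"] by eventually_elim (rule bounds)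
  have "(\<lambda>m. C / harm m) \<longlonglongrightarrow> 0"
    by (rule real_tendsto_divide_at_top[OF tendsto_const harm_at_top])
  with lower upper have "(\<lambda>m. euler_mascheroni - S m) \<longlonglongrightarrow> 0"
    by (rule tendsto_sandwich[OF _ _ tendsto_const])
  from tendsto_diff[OF tendsto_const[of euler_mascheroni] this]
  show ?thesis unfolding S_def by simp
qed

end
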